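(* Let $t\in\mathbb{N}$ and $\Omega=\{1,\dots,n\}$. The following operations on set functions $2^\Omega\to\mathbb{R}$ maintain $t$-sos-submodularity: (1) (Nonnegative weighted sums) If $f_1,\dots,f_m$ are $t$-sos-submodular and $w_1,\dots,w_m\ge0$, then $w_1f_1+\dots+w_mf_m$ is $t$-sos-submodular. (2) (Complementation) If $f$ is $t$-sos-submodular, then $g(S)=f(\Omega\setminus S)$ is $t$-sos-submodular. (3) (Restriction) If $f$ is $t$-sos-submodular and $A\subseteq\Omega$ is fixed, then $g(S)=f(S\cap A)$ is $t$-sos-submodular. (4) (Contraction) If $f$ is $t$-sos-submodular and $A\subseteq\Omega$ is fixed, then $g(S)=f(S\cup A)-f(A)$ is $t$-sos-submodular.
   Context: $\mathbb{N}$ includes $0$. The multilinear extension (MLE) of a set function $f:2^\Omega\to\mathbb{R}$ is the unique multilinear polynomial $F\in\mathbb{R}[x_1,\dots,x_n]$ (every variable appears with power at most $1$ in every monomial) with $F(1_S)=f(S)$ for all $S\subseteq\Omega$, where $1_S\in\{0,1\}^n$ is the indicator vector of $S$. For an ideal $I$ of a real polynomial ring, a polynomial $p$ is $t$-sos modulo $I$ if there are finitely many polynomials $q_1,\dots,q_m$ in that ring, each of degree at most $t$, with $p-\sum_{r=1}^m q_r^2\in I$. For $i\ne j$, $x_{-i,j}$ denotes the variables $x_1,\dots,x_n$ with $x_i,x_j$ removed, and $I_2[x_{-i,j}]=\langle x_k^2-x_k : k\neq i,j\rangle\subseteq\mathbb{R}[x_{-i,j}]$. The set function $f$ with MLE $F$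 is $t$-sos-submodular if for all $i\neq j$ the polynomial $-\frac{\partial^2F(x)}{\partial x_i\partial x_j}$ (which does not involve $x_i,x_j$) is $t$-sos modulo $I_2[x_{-i,j}]$. *)

theory Defs
  imports Complex_Main "HOL-Library.Poly_Mapping" "HOL-Library.Indicator_Function"
begin

(* Real polynomials in variables x_k, k a natural number: a monomial maps variables to
   exponents, a polynomial maps monomials to coefficients. Multiplication is the
   convolution product of Poly_Mapping. *)
type_synonym monomial = "nat \<Rightarrow>\<^sub>0 nat"
type_synonym real_mpoly = "monomial \<Rightarrow>\<^sub>0 real"

definition polys_in :: "nat set \<Rightarrow> real_mpoly set" where
  "polys_in V = {p. \<forall>m\<in>Poly_Mapping.keys p. Poly_Mapping.keys m \<subseteq> V}"

definition var :: "nat \<Rightarrow> real_mpoly" where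
  "var k = Poly_Mapping.single (Poly_Mapping.single k 1) 1"

definition monomial_degree :: "monomial \<Rightarrow> nat" where
  "monomial_degree m = (\<Sum>k\<in>Poly_Mapping.keys m. Poly_Mapping.lookup m k)"

(* The zero polynomial gets degree 0, so that it satisfies every degree bound. *)
definition total_degree :: "real_mpoly \<Rightarrow> nat" where
  "total_degree p = Max (insert 0 (monomial_degree ` Poly_Mapping.keys p))"

definition eval_mpoly :: "(nat \<Rightarrow> real) \<Rightarrow> real_mpoly \<Rightarrow> real" where
  "eval_mpoly x p = (\<Sum>m\<in>Poly_Mapping.keys p. Poly_Mapping.lookup p m * (\<Prod>k\<in>Poly_Mapping.keys m. x k ^ Poly_Mapping.lookup m k))"

(* If x_i does not occur in m, the coefficient of the summand is 0 and the truncated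
   difference of exponents is irrelevant. *)
definition partial_deriv :: "nat \<Rightarrow> real_mpoly \<Rightarrow> real_mpoly" where
  "partial_deriv i p =
    (\<Sum>m\<in>Poly_Mapping.keys p. Poly_Mapping.single (m - Poly_Mapping.single i 1) (real (Poly_Mapping.lookup m i) * Poly_Mapping.lookup p m))"

definition multilinear :: "real_mpoly \<Rightarrow> bool" where
  "multilinear p \<longleftrightarrow> (\<forall>m\<in>Poly_Mapping.keys p. \<forall>k. Poly_Mapping.lookup m k \<le> 1)"

(* A set function on the subsets of \<Omega> is represented by a function on all sets of
   naturals; only its values on subsets of \<Omega> are ever used. *)
definition is_mle :: "nat set \<Rightarrow> (nat set \<Rightarrow> real) \<Rightarrow> real_mpoly \<Rightarrow> bool" where
  "is_mle \<Omega> f F \<longleftrightarrow>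
    F \<in> polys_in \<Omega> \<and> multilinear F \<and> (\<forall>S. S \<subseteq> \<Omega> \<longrightarrow> eval_mpoly (indicator S) F = f S)"

(* Well defined for finite \<Omega>: see ex1_mle below. *)
definition mle :: "nat set \<Rightarrow> (nat set \<Rightarrow> real) \<Rightarrow> real_mpoly" where
  "mle \<Omega> f = (THE F. is_mle \<Omega> f F)"

(* The ideal of the subring R generated by B: the multipliers are taken from R. *)
definition ideal_gen :: "real_mpoly set \<Rightarrow> real_mpoly set \<Rightarrow> real_mpoly set" where
  "ideal_gen R B =
    {\<Sum>b\<in>T. c b * b | T c. finite T \<and> T \<subseteq> B \<and> (\<forall>b\<in>T. c b \<in> R)}"

definition I2 :: "nat set \<Rightarrow> real_mpoly set" where
  "I2 V = ideal_gen (polys_in V) ((\<lambda>k. (var k)\<^sup>2 - var k) ` V)"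

definition sos_mod :: "real_mpoly set \<Rightarrow> real_mpoly set \<Rightarrow> nat \<Rightarrow> real_mpoly \<Rightarrow> bool" where
  "sos_mod R I t p \<longleftrightarrow>
    (\<exists>(m::nat) q. (\<forall>r\<in>{1..m}. q r \<in> R \<and> total_degree (q r) \<le> t) \<and>
       p - (\<Sum>r=1..m. (q r)\<^sup>2) \<in> I)"

definition sos_submodular :: "nat set \<Rightarrow> nat \<Rightarrow> (nat set \<Rightarrow> real) \<Rightarrow> bool" where
  "sos_submodular \<Omega> t f \<longleftrightarrow>
    (\<forall>i\<in>\<Omega>. \<forall>j\<in>\<Omega>. i \<noteq> j \<longrightarrow>
       sos_mod (polys_in (\<Omega> - {i, j})) (I2 (\<Omega> - {i, j})) t
         (- partial_deriv i (partial_deriv j (mle \<Omega> f))))"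

definition set_monomial :: "nat set \<Rightarrow> monomial" where
  "set_monomial T = (\<Sum>k\<in>T. Poly_Mapping.single k 1)"

lemma lookup_set_monomial: "finite T \<Longrightarrow> Poly_Mapping.lookup (set_monomial T) k = of_bool (k \<in> T)"
  unfolding set_monomial_def lookup_sum
  by (simp add: lookup_single when_def)

lemma keys_set_monomial [simp]: "finite T \<Longrightarrow> Poly_Mapping.keys (set_monomial T) = T"
  by (auto simp: in_keys_iff lookup_set_monomial)

lemma set_monomial_keys: "(\<And>k. Poly_Mapping.lookup m k \<le> 1) \<Longrightarrow> set_monomial (Poly_Mapping.keys m) = m"
proof (rule poly_mapping_eqI)
  fix k assume "\<And>k. Poly_Mapping.lookup m k \<le> 1"
  from this[of k] show "Poly_Mapping.lookup (set_monomial (Poly_Mapping.keys m)) k = Poly_Mapping.lookup m k"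
    by (auto simp: lookup_set_monomial in_keys_iff)
qed

lemma eval_multilinear_indicator:
  assumes "multilinear p" "finite S"
  shows "eval_mpoly (indicator S) p = (\<Sum>T\<in>Pow S. Poly_Mapping.lookup p (set_monomial T))"
proof -
  have "(\<Prod>k\<in>Poly_Mapping.keys m. (indicator S k :: real) ^ Poly_Mapping.lookup m k) = of_bool (Poly_Mapping.keys m \<subseteq> S)" for m
  proof (cases "Poly_Mapping.keys m \<subseteq> S")
    case True
    then show ?thesis by (auto intro!: prod.neutral simp: indicator_def)
  next
    case False
    then obtain k where "k \<in> Poly_Mapping.keys m" "k \<notin> S" by blast
    then have "(indicator S k :: real) ^ Poly_Mapping.lookup m k = 0"
      by (auto simp: in_keys_iff)
    with \<open>k \<in> Poly_Mapping.keys m\<close> have "(\<Prod>k\<in>Poly_Mapping.keys m. (indicator S k :: real) ^ Poly_Mapping.lookup m k) = 0"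
      by (intro prod_zero) auto
    with False show ?thesis by simp
  qed
  then have "eval_mpoly (indicator S) p = (\<Sum>m\<in>Poly_Mapping.keys p. if Poly_Mapping.keys m \<subseteq> S then Poly_Mapping.lookup p m else 0)"
    unfolding eval_mpoly_def by (intro sum.cong) simp_all
  also have "\<dots> = (\<Sum>m | m \<in> Poly_Mapping.keys p \<and> Poly_Mapping.keys m \<subseteq> S. Poly_Mapping.lookup p m)"
    by (simp add: sum.If_cases Int_def)
  also have "\<dots> = (\<Sum>T | T \<in> Pow S \<and> set_monomial T \<in> Poly_Mapping.keys p. Poly_Mapping.lookup p (set_monomial T))"
    by (rule sum.reindex_bij_witness[where i = set_monomial and j = Poly_Mapping.keys])
      (use assms in \<open>auto simp: multilinear_def set_monomial_keys finite_subset\<close>)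
  also have "\<dots> = (\<Sum>T\<in>Pow S. Poly_Mapping.lookup p (set_monomial T))"
    by (rule sum.mono_neutral_left) (use assms in \<open>auto simp: in_keys_iff\<close>)
  finally show ?thesis .
qed

lemma ex1_mle:
  assumes "finite \<Omega>"
  shows "\<exists>!F. is_mle \<Omega> f F"
proof (rule ex_ex1I)
  define g where "g S = (\<Sum>T\<in>Pow S. (- 1) ^ card T * f T)" for S :: "nat set"
  define c where "c T = (- 1) ^ card T * g T" for T :: "nat set"
  have c: "f S = (\<Sum>T\<in>Pow S. c T)" if "finite S" for S
    unfolding c_def using that
    by (rule inclusion_exclusion_symmetric[rotated]) (simp add: g_def)
  define F :: real_mpoly where "F = (\<Sum>T\<in>Pow \<Omega>. Poly_Mapping.single (set_monomial T) (c T))"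
  have keysF: "Poly_Mapping.keys F \<subseteq> set_monomial ` Pow \<Omega>"
    unfolding F_def using keys_sum[of "\<lambda>T. Poly_Mapping.single (set_monomial T) (c T)" "Pow \<Omega>"]
    by (rule order_trans) (auto split: if_splits)
  have inj: "set_monomial T = set_monomial U \<longleftrightarrow> T = U" if "T \<subseteq> \<Omega>" "U \<subseteq> \<Omega>" for T U
    using keys_set_monomial[OF finite_subset[OF that(1) assms]]
      keys_set_monomial[OF finite_subset[OF that(2) assms]] by metis
  have lookF: "Poly_Mapping.lookup F (set_monomial U) = c U" if "U \<subseteq> \<Omega>" for U
  proof -
    have "Poly_Mapping.lookup F (set_monomial U) = (\<Sum>T\<in>Pow \<Omega>. if T = U then c T else 0)"
      unfolding F_def lookup_sum
      by (rule sum.cong) (use inj that in \<open>auto simp: lookup_single when_def\<close>)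
    then show ?thesis using that assms by simp
  qed
  have "multilinear F"
    unfolding multilinear_def
  proof (intro ballI allI)
    fix m k assume "m \<in> Poly_Mapping.keys F"
    then obtain T where "T \<subseteq> \<Omega>" "m = set_monomial T" using keysF by auto
    then show "Poly_Mapping.lookup m k \<le> 1"
      using finite_subset[OF _ assms] by (simp add: lookup_set_monomial)
  qed
  moreover have "F \<in> polys_in \<Omega>"
    unfolding polys_in_def
  proof (intro CollectI ballI)
    fix m assume "m \<in> Poly_Mapping.keys F"
    then obtain T where "T \<subseteq> \<Omega>" "m = set_monomial T" using keysF by auto
    then show "Poly_Mapping.keys m \<subseteq> \<Omega>"
      using finite_subset[OF \<open>T \<subseteq> \<Omega>\<close> assms] by simp
  qed
  moreover have "eval_mpoly (indicator S) F = f S" if "S \<subseteq> \<Omega>" for S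
  proof -
    have "finite S" using that assms finite_subset by blast
    then show ?thesis
      unfolding eval_multilinear_indicator[OF \<open>multilinear F\<close> \<open>finite S\<close>] c[OF \<open>finite S\<close>]
      using that by (intro sum.cong lookF) auto
  qed
  ultimately show "\<exists>F. is_mle \<Omega> f F" unfolding is_mle_def by blast
next
  fix F G assume FG: "is_mle \<Omega> f F" "is_mle \<Omega> f G"
  have eq: "Poly_Mapping.lookup F (set_monomial T) = Poly_Mapping.lookup G (set_monomial T)" if "T \<subseteq> \<Omega>" for T
  proof -
    have "finite T" using that assms finite_subset by blast
    then show ?thesis using that
    proof (induction T rule: finite_psubset_induct)
      case (psubset T)
      have "(\<Sum>U\<in>Pow T. Poly_Mapping.lookup F (set_monomial U)) = (\<Sum>U\<in>Pow T. Poly_Mapping.lookup G (set_monomial U))"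
        using FG psubset.prems psubset.hyps
        unfolding is_mle_def by (simp flip: eval_multilinear_indicator)
      moreover have "(\<Sum>U\<in>Pow T - {T}. Poly_Mapping.lookup F (set_monomial U)) = (\<Sum>U\<in>Pow T - {T}. Poly_Mapping.lookup G (set_monomial U))"
        by (rule sum.cong) (use psubset in auto)
      moreover have "(\<Sum>U\<in>Pow T. h U) = h T + (\<Sum>U\<in>Pow T - {T}. h U)" for h :: "nat set \<Rightarrow> real"
        using psubset.hyps by (intro sum.remove) auto
      ultimately show ?case by simp
    qed
  qed
  show "F = G"
  proof (rule poly_mapping_eqI)
    fix m
    show "Poly_Mapping.lookup F m = Poly_Mapping.lookup G m"
    proof (cases "m \<in> Poly_Mapping.keys F \<or> m \<in> Poly_Mapping.keys G")
      case True
      then have "Poly_Mapping.keys m \<subseteq> \<Omega>" "set_monomial (Poly_Mapping.keys m) = m"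
        using FG by (auto simp: is_mle_def polys_in_def multilinear_def intro!: set_monomial_keys)
      then show ?thesis using eq[of "Poly_Mapping.keys m"] by simp
    next
      case False
      then show ?thesis by (simp add: in_keys_iff)
    qed
  qed
qed

end

theory Submission
  imports Defs
begin

text \<open>
  A real polynomial over finitely many variables lies in the ideal generated by the
  \<open>x\<^sub>k\<^sup>2 - x\<^sub>k\<close> exactly when it vanishes on the vertices of the cube: modulo the ideal it agrees
  with a multilinear polynomial, and a multilinear polynomial vanishing on the cube is zero.
  Hence being \<open>t\<close>-sos modulo this ideal depends only on the values at the vertices, and means that
  these values form a sum of squares of polynomial functions of degree at most \<open>t\<close>
  (\<open>sos_mod_I2_iff_cube_sos\<close>).

  For a multilinear polynomial a partial derivative is the difference between setting the variable
  to 1 and to 0. So at the vertex \<open>1\<^sub>S\<close> the negative mixed second derivative of the multilinear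
  extension of \<open>f\<close> is \<open>f(S + i) + f(S + j) - f(S) - f(S + i + j)\<close>, the gap in the submodularity
  inequality. Together, \<open>f\<close> is \<open>t\<close>-sos-submodular iff each of its gaps is a sum of squares of degree
  at most \<open>t\<close> on the cube (\<open>sos_submodular_iff_gap_cube_sos\<close>), and multilinear extensions
  disappear from the problem.

  The gap is linear in \<open>f\<close>, which gives nonnegative weighted sums. For complementation, restriction
  and contraction, each gap of the new function is either identically zero or a gap of \<open>f\<close> at
  a transformed vertex, where the transformation replaces each coordinate \<open>x\<^sub>k\<close> by
  \<open>a\<^sub>k + b\<^sub>k x\<^sub>k\<close>: by \<open>1 - x\<^sub>k\<close> for complementation, and by \<open>x\<^sub>k\<close> or a constant 0 or 1 in the other
  two cases. Such a substitution does not raise degrees, so it carries one sum of squares to the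
  other (\<open>cube_sos_affine_pullback\<close>).
\<close>

section \<open>Evaluation of polynomials\<close>

definition eval_monomial :: "(nat \<Rightarrow> real) \<Rightarrow> monomial \<Rightarrow> real" where
  "eval_monomial x m = (\<Prod>k\<in>Poly_Mapping.keys m. x k ^ Poly_Mapping.lookup m k)"

lemma eval_mpoly_eq: "eval_mpoly x p = (\<Sum>m\<in>Poly_Mapping.keys p. Poly_Mapping.lookup p m * eval_monomial x m)"
  by (simp add: eval_mpoly_def eval_monomial_def)

lemma eval_monomial_superset:
  assumes "finite K" "Poly_Mapping.keys m \<subseteq> K"
  shows "eval_monomial x m = (\<Prod>k\<in>K. x k ^ Poly_Mapping.lookup m k)"
  unfolding eval_monomial_def
  by (rule prod.mono_neutral_left) (use assms in \<open>auto simp: in_keys_iff\<close>)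

lemma eval_mpoly_superset:
  assumes "finite M" "Poly_Mapping.keys p \<subseteq> M"
  shows "eval_mpoly x p = (\<Sum>m\<in>M. Poly_Mapping.lookup p m * eval_monomial x m)"
  unfolding eval_mpoly_eq
  by (rule sum.mono_neutral_left) (use assms in \<open>auto simp: in_keys_iff\<close>)

lemma eval_monomial_add: "eval_monomial x (m + m') = eval_monomial x m * eval_monomial x m'"
proof -
  let ?K = "Poly_Mapping.keys m \<union> Poly_Mapping.keys m'"
  have "Poly_Mapping.keys (m + m') \<subseteq> ?K" by (rule Poly_Mapping.keys_add)
  then show ?thesis
    by (simp add: eval_monomial_superset[of ?K] lookup_add power_add prod.distrib)
qed

lemma eval_mpoly_zero [simp]: "eval_mpoly x 0 = 0"
  by (simp add: eval_mpoly_eq)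

lemma eval_mpoly_single [simp]: "eval_mpoly x (Poly_Mapping.single m c) = c * eval_monomial x m"
  by (simp add: eval_mpoly_eq)

lemma eval_mpoly_add [simp]: "eval_mpoly x (p + q) = eval_mpoly x p + eval_mpoly x q"
proof -
  let ?M = "Poly_Mapping.keys p \<union> Poly_Mapping.keys q"
  have "Poly_Mapping.keys (p + q) \<subseteq> ?M" by (rule Poly_Mapping.keys_add)
  then show ?thesis
    by (simp add: eval_mpoly_superset[of ?M] lookup_add distrib_right sum.distrib)
qed

lemma eval_mpoly_minus [simp]: "eval_mpoly x (- p) = - eval_mpoly x p"
  by (simp add: eval_mpoly_eq sum_negf)

lemma eval_mpoly_diff [simp]: "eval_mpoly x (p - q) = eval_mpoly x p - eval_mpoly x q"
  using eval_mpoly_add[of x p "- q"] by simp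

lemma eval_mpoly_sum [simp]: "eval_mpoly x (\<Sum>a\<in>A. g a) = (\<Sum>a\<in>A. eval_mpoly x (g a))"
  by (induction A rule: infinite_finite_induct) auto

lemma sum_monomials: "(\<Sum>m\<in>Poly_Mapping.keys p. Poly_Mapping.single m (Poly_Mapping.lookup p m)) = p"
proof (rule poly_mapping_eqI)
  fix k
  show "Poly_Mapping.lookup (\<Sum>m\<in>Poly_Mapping.keys p. Poly_Mapping.single m (Poly_Mapping.lookup p m)) k
      = Poly_Mapping.lookup p k"
    by (simp add: lookup_sum lookup_single when_def in_keys_iff)
qed

lemma eval_mpoly_mult [simp]: "eval_mpoly x (p * q) = eval_mpoly x p * eval_mpoly x q"
proof -
  let ?mono = "\<lambda>r m. Poly_Mapping.single m (Poly_Mapping.lookup r m) :: real_mpoly"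
  have "p * q = (\<Sum>m\<in>Poly_Mapping.keys p. \<Sum>m'\<in>Poly_Mapping.keys q. ?mono p m * ?mono q m')"
    unfolding sum_product[symmetric] sum_monomials ..
  also have "eval_mpoly x \<dots> = eval_mpoly x p * eval_mpoly x q"
    by (simp add: mult_single eval_monomial_add eval_mpoly_eq[of _ p] eval_mpoly_eq[of _ q] sum_product mult_ac)
  finally show ?thesis .
qed

lemma eval_mpoly_var [simp]: "eval_mpoly x (var k) = x k"
  by (simp add: var_def eval_monomial_def)

lemma eval_mpoly_power2 [simp]: "eval_mpoly x (p\<^sup>2) = (eval_mpoly x p)\<^sup>2"
  by (simp add: power2_eq_square)

lemma eval_mpoly_cong:
  assumes "p \<in> polys_in V" "\<And>k. k \<in> V \<Longrightarrow> x k = y k"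
  shows "eval_mpoly x p = eval_mpoly y p"
  unfolding eval_mpoly_def
  by (intro sum.cong prod.cong arg_cong2[where f = "(*)"] refl arg_cong[where f = "\<lambda>c. c ^ _"])
    (use assms in \<open>auto simp: polys_in_def\<close>)

section \<open>Polynomials of bounded degree\<close>

definition bounded_polys :: "nat set \<Rightarrow> nat \<Rightarrow> real_mpoly set" where
  "bounded_polys V t = {p \<in> polys_in V. total_degree p \<le> t}"

lemma bounded_polys_iff:
  "p \<in> bounded_polys V t \<longleftrightarrow>
    (\<forall>m\<in>Poly_Mapping.keys p. Poly_Mapping.keys m \<subseteq> V \<and> monomial_degree m \<le> t)"
  by (auto simp: bounded_polys_def polys_in_def total_degree_def)

lemma monomial_degree_superset:
  assumes "finite K" "Poly_Mapping.keys m \<subseteq> K"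
  shows "monomial_degree m = (\<Sum>k\<in>K. Poly_Mapping.lookup m k)"
  unfolding monomial_degree_def
  by (rule sum.mono_neutral_left) (use assms in \<open>auto simp: in_keys_iff\<close>)

lemma monomial_degree_add: "monomial_degree (m + m') = monomial_degree m + monomial_degree m'"
proof -
  let ?K = "Poly_Mapping.keys m \<union> Poly_Mapping.keys m'"
  have "Poly_Mapping.keys (m + m') \<subseteq> ?K" by (rule Poly_Mapping.keys_add)
  then show ?thesis
    by (simp add: monomial_degree_superset[of ?K] lookup_add sum.distrib)
qed

lemma keys_add_nat:
  "Poly_Mapping.keys (m + m' :: monomial) = Poly_Mapping.keys m \<union> Poly_Mapping.keys m'"
  by (auto simp: in_keys_iff lookup_add)

lemma bounded_polys_const: "Poly_Mapping.single 0 c \<in> bounded_polys V t"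
  by (auto simp: bounded_polys_iff monomial_degree_def)

lemma bounded_polys_var: "k \<in> V \<Longrightarrow> var k \<in> bounded_polys V 1"
  by (auto simp: bounded_polys_iff monomial_degree_def var_def)

lemma bounded_polys_add:
  "p \<in> bounded_polys V t \<Longrightarrow> q \<in> bounded_polys V t \<Longrightarrow> p + q \<in> bounded_polys V t"
  using Poly_Mapping.keys_add[of p q] by (auto simp: bounded_polys_iff)

lemma bounded_polys_mult:
  "p \<in> bounded_polys V s \<Longrightarrow> q \<in> bounded_polys V t \<Longrightarrow> p * q \<in> bounded_polys V (s + t)"
  using keys_mult[of p q]
  by (fastforce simp: bounded_polys_iff keys_add_nat monomial_degree_add intro: add_mono)

lemma bounded_polys_sum:
  "(\<And>a. a \<in> A \<Longrightarrow> g a \<in> bounded_polys V t) \<Longrightarrow> (\<Sum>a\<in>A. g a) \<in> bounded_polys V t"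
  using bounded_polys_const[of 0 V t]
  by (induction A rule: infinite_finite_induct) (auto intro: bounded_polys_add)

lemma bounded_polys_mono: "s \<le> t \<Longrightarrow> bounded_polys V s \<subseteq> bounded_polys V t"
  by (auto simp: bounded_polys_def)

lemma polys_in_bounded: "p \<in> polys_in V \<longleftrightarrow> (\<exists>t. p \<in> bounded_polys V t)"
  by (auto simp: bounded_polys_def)

lemma polys_in_zero [simp]: "0 \<in> polys_in V"
  by (simp add: polys_in_def)

lemma polys_in_add: "p \<in> polys_in V \<Longrightarrow> q \<in> polys_in V \<Longrightarrow> p + q \<in> polys_in V"
  using Poly_Mapping.keys_add[of p q] by (auto simp: polys_in_def)

lemma polys_in_minus: "p \<in> polys_in V \<Longrightarrow> - p \<in> polys_in V"
  by (simp add: polys_in_def)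

lemma polys_in_diff: "p \<in> polys_in V \<Longrightarrow> q \<in> polys_in V \<Longrightarrow> p - q \<in> polys_in V"
  using keys_diff[of p q] by (auto simp: polys_in_def)

lemma polys_in_mult: "p \<in> polys_in V \<Longrightarrow> q \<in> polys_in V \<Longrightarrow> p * q \<in> polys_in V"
  using bounded_polys_mult unfolding polys_in_bounded by blast

lemma polys_in_sum: "(\<And>a. a \<in> A \<Longrightarrow> g a \<in> polys_in V) \<Longrightarrow> (\<Sum>a\<in>A. g a) \<in> polys_in V"
  by (induction A rule: infinite_finite_induct) (auto intro: polys_in_add)

text \<open>Substituting an affine form in the single variable \<open>x\<^sub>k\<close> for each \<open>x\<^sub>k\<close> turns a monomial into
  a product of as many factors of degree at most 1 as its degree. The polynomial is described by its
  values, which is all that sums of squares on the cube require of it.\<close>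

lemma bounded_polys_affine_substitution_monomial:
  assumes "finite K" "K \<subseteq> V"
  shows "\<exists>q\<in>bounded_polys V (\<Sum>k\<in>K. e k). \<forall>x. eval_mpoly x q = (\<Prod>k\<in>K. (a k + b k * x k) ^ e k)"
  using assms
proof (induction K)
  case empty
  show ?case
    by (rule bexI[of _ "Poly_Mapping.single 0 1"])
      (simp_all add: bounded_polys_const eval_monomial_def del: single_one)
next
  case (insert k K)
  define l where "l = Poly_Mapping.single 0 (a k) + Poly_Mapping.single 0 (b k) * var k"
  have l: "l \<in> bounded_polys V 1"
    using insert.prems bounded_polys_mult[OF bounded_polys_const[of "b k" V 0] bounded_polys_var[of k V]]
    by (simp add: l_def bounded_polys_add bounded_polys_const)
  have eval_l: "eval_mpoly x l = a k + b k * x k" for x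
    by (simp add: l_def eval_monomial_def)
  have "\<exists>q\<in>bounded_polys V n. \<forall>x. eval_mpoly x q = (a k + b k * x k) ^ n" for n
  proof (induction n)
    case 0
    show ?case
      by (rule bexI[of _ "Poly_Mapping.single 0 1"])
        (simp_all add: bounded_polys_const eval_monomial_def del: single_one)
  next
    case (Suc n)
    then obtain q where "q \<in> bounded_polys V n" "\<forall>x. eval_mpoly x q = (a k + b k * x k) ^ n" by blast
    then show ?case
      using bounded_polys_mult[OF l, of q n] by (intro bexI[of _ "l * q"]) (auto simp: eval_l)
  qed
  then obtain p where p: "p \<in> bounded_polys V (e k)" "\<And>x. eval_mpoly x p = (a k + b k * x k) ^ e k"
    by blast
  from insert obtain q where q: "q \<in> bounded_polys V (\<Sum>k\<in>K. e k)"
      "\<And>x. eval_mpoly x q = (\<Prod>k\<in>K. (a k + b k * x k) ^ e k)"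
    by auto
  show ?case
    using insert.hyps bounded_polys_mult[OF p(1) q(1)]
    by (intro bexI[of _ "p * q"]) (auto simp: p(2) q(2))
qed

lemma bounded_polys_affine_substitution:
  assumes "q \<in> bounded_polys V t"
  obtains q' where "q' \<in> bounded_polys V t"
    "\<And>x. eval_mpoly x q' = eval_mpoly (\<lambda>k. a k + b k * x k) q"
proof -
  have "\<exists>r\<in>bounded_polys V t. \<forall>x. eval_mpoly x r = eval_monomial (\<lambda>k. a k + b k * x k) m"
    if "m \<in> Poly_Mapping.keys q" for m
  proof -
    have m: "Poly_Mapping.keys m \<subseteq> V" "monomial_degree m \<le> t"
      using assms that by (auto simp: bounded_polys_iff)
    then show ?thesis
      using bounded_polys_affine_substitution_monomial[OF finite_keys m(1), of "Poly_Mapping.lookup m" a b]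
        bounded_polys_mono[OF m(2), of V]
      unfolding eval_monomial_def monomial_degree_def by blast
  qed
  then obtain r where r: "\<And>m. m \<in> Poly_Mapping.keys q \<Longrightarrow> r m \<in> bounded_polys V t"
      "\<And>m x. m \<in> Poly_Mapping.keys q \<Longrightarrow> eval_mpoly x (r m) = eval_monomial (\<lambda>k. a k + b k * x k) m"
    by metis
  let ?q = "\<Sum>m\<in>Poly_Mapping.keys q. Poly_Mapping.single 0 (Poly_Mapping.lookup q m) * r m"
  show ?thesis
  proof
    show "?q \<in> bounded_polys V t"
      using bounded_polys_mult[OF bounded_polys_const[of _ V 0] r(1)] by (intro bounded_polys_sum) auto
    show "eval_mpoly x ?q = eval_mpoly (\<lambda>k. a k + b k * x k) q" for x
      using r(2) by (simp add: eval_mpoly_eq[of _ q] eval_monomial_def[of _ 0])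
  qed
qed

section \<open>The vanishing ideal of the cube\<close>

lemma ideal_gen_zero: "0 \<in> ideal_gen R B"
  unfolding ideal_gen_def by (intro CollectI exI[of _ "{}"]) auto

lemma ideal_gen_generator: "b \<in> B \<Longrightarrow> r \<in> R \<Longrightarrow> r * b \<in> ideal_gen R B"
  unfolding ideal_gen_def by (intro CollectI exI[of _ "{b}"] exI[of _ "\<lambda>_. r"]) auto

lemma ideal_gen_add:
  assumes R: "0 \<in> R" "\<And>p q. p \<in> R \<Longrightarrow> q \<in> R \<Longrightarrow> p + q \<in> R"
    and "u \<in> ideal_gen R B" "v \<in> ideal_gen R B"
  shows "u + v \<in> ideal_gen R B"
proof -
  obtain T c where T: "finite T" "T \<subseteq> B" "\<forall>b\<in>T. c b \<in> R" "u = (\<Sum>b\<in>T. c b * b)"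
    using assms(3) unfolding ideal_gen_def by blast
  obtain T' c' where T': "finite T'" "T' \<subseteq> B" "\<forall>b\<in>T'. c' b \<in> R" "v = (\<Sum>b\<in>T'. c' b * b)"
    using assms(4) unfolding ideal_gen_def by blast
  \<comment> \<open>Coefficients extended by 0, so that both combinations run over the same generators.\<close>
  let ?d = "\<lambda>b. if b \<in> T then c b else 0" and ?d' = "\<lambda>b. if b \<in> T' then c' b else 0"
  have "u = (\<Sum>b\<in>T \<union> T'. ?d b * b)"
    unfolding T(4) using T(1) T'(1) by (intro sum.mono_neutral_cong_left) auto
  moreover have "v = (\<Sum>b\<in>T \<union> T'. ?d' b * b)"
    unfolding T'(4) using T(1) T'(1) by (intro sum.mono_neutral_cong_left) auto
  ultimately have "u + v = (\<Sum>b\<in>T \<union> T'. (?d b + ?d' b) * b)"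
    by (simp only: sum.distrib distrib_right)
  moreover have "\<forall>b\<in>T \<union> T'. ?d b + ?d' b \<in> R"
    using T(3) T'(3) R by auto
  ultimately show ?thesis
    unfolding ideal_gen_def using T T'
    by (intro CollectI exI[of _ "T \<union> T'"] exI[of _ "\<lambda>b. ?d b + ?d' b"]) auto
qed

lemma ideal_gen_mult:
  assumes R: "\<And>p q. p \<in> R \<Longrightarrow> q \<in> R \<Longrightarrow> p * q \<in> R" and "r \<in> R" "u \<in> ideal_gen R B"
  shows "r * u \<in> ideal_gen R B"
proof -
  obtain T c where T: "finite T" "T \<subseteq> B" "\<forall>b\<in>T. c b \<in> R" "u = (\<Sum>b\<in>T. c b * b)"
    using assms(3) unfolding ideal_gen_def by blast
  then show ?thesis
    unfolding ideal_gen_def using assms(1,2)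
    by (intro CollectI exI[of _ T] exI[of _ "\<lambda>b. r * c b"]) (auto simp: sum_distrib_left mult.assoc)
qed

lemma I2_add: "u \<in> I2 V \<Longrightarrow> v \<in> I2 V \<Longrightarrow> u + v \<in> I2 V"
  unfolding I2_def by (rule ideal_gen_add) (auto intro: polys_in_add)

lemma I2_zero: "0 \<in> I2 V"
  unfolding I2_def by (rule ideal_gen_zero)

lemma I2_mult: "r \<in> polys_in V \<Longrightarrow> u \<in> I2 V \<Longrightarrow> r * u \<in> I2 V"
  unfolding I2_def by (rule ideal_gen_mult) (auto intro: polys_in_mult)

lemma I2_sum: "(\<And>a. a \<in> A \<Longrightarrow> g a \<in> I2 V) \<Longrightarrow> (\<Sum>a\<in>A. g a) \<in> I2 V"
  by (induction A rule: infinite_finite_induct) (auto intro: I2_add I2_zero)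

lemma I2_vanishes:
  assumes "u \<in> I2 V"
  shows "eval_mpoly (indicator S) u = 0"
proof -
  obtain T c where "T \<subseteq> (\<lambda>k. (var k)\<^sup>2 - var k) ` V" "u = (\<Sum>b\<in>T. c b * b)"
    using assms unfolding I2_def ideal_gen_def by blast
  moreover have "eval_mpoly (indicator S) ((var k)\<^sup>2 - var k) = 0" for k
    by (simp add: indicator_def)
  ultimately show ?thesis by (auto intro!: sum.neutral)
qed

text \<open>A factor \<open>x\<^sub>k\<^sup>2\<close> can be traded for \<open>x\<^sub>k\<close> modulo the ideal, because
  \<open>x\<^sup>m x\<^sub>k\<^sup>2 - x\<^sup>m x\<^sub>k = x\<^sup>m (x\<^sub>k\<^sup>2 - x\<^sub>k)\<close>. This lowers the degree and keeps the set of occurring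
  variables, so it ends at the squarefree monomial on the same variables.\<close>

lemma I2_monomial_reduction:
  assumes "Poly_Mapping.keys m \<subseteq> V"
  shows "Poly_Mapping.single m 1 - Poly_Mapping.single (set_monomial (Poly_Mapping.keys m)) 1 \<in> I2 V"
  using assms
proof (induction "monomial_degree m" arbitrary: m rule: less_induct)
  case less
  show ?case
  proof (cases "\<forall>k. Poly_Mapping.lookup m k \<le> 1")
    case True
    then show ?thesis by (simp add: set_monomial_keys I2_zero)
  next
    case False
    then obtain k where k: "Poly_Mapping.lookup m k \<ge> 2" by (metis not_less_eq_eq one_add_one plus_1_eq_Suc)
    let ?e = "Poly_Mapping.single k 1 :: monomial"
    define m0 where "m0 = m - ?e - ?e"
    have m: "m = m0 + ?e + ?e"
      by (rule poly_mapping_eqI) (use k in \<open>auto simp: m0_def lookup_add lookup_minus lookup_single when_def\<close>)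
    let ?m' = "m0 + ?e"
    have keys: "Poly_Mapping.keys ?m' = Poly_Mapping.keys m"
      unfolding m keys_add_nat by auto
    have "monomial_degree ?m' < monomial_degree m"
      unfolding m monomial_degree_add by (simp add: monomial_degree_def[of "Poly_Mapping.single k (Suc 0)"])
    then have IH: "Poly_Mapping.single ?m' 1 - Poly_Mapping.single (set_monomial (Poly_Mapping.keys m)) 1 \<in> I2 V"
      using less.hyps[of ?m'] less.prems keys by simp
    have "k \<in> V" using less.prems k by (auto simp: in_keys_iff)
    moreover have "Poly_Mapping.single m0 1 \<in> polys_in V"
      using less.prems unfolding m keys_add_nat by (simp add: polys_in_def)
    ultimately have "Poly_Mapping.single m0 1 * ((var k)\<^sup>2 - var k) \<in> I2 V"
      unfolding I2_def by (intro ideal_gen_generator) auto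
    moreover have "Poly_Mapping.single m0 1 * ((var k)\<^sup>2 - var k)
        = Poly_Mapping.single m (1::real) - Poly_Mapping.single ?m' 1"
      by (simp add: var_def power2_eq_square mult_single right_diff_distrib m add.assoc)
    ultimately have "Poly_Mapping.single m 1 - Poly_Mapping.single ?m' 1 \<in> I2 V" by simp
    from I2_add[OF this IH] show ?thesis by (simp add: add_diff_eq)
  qed
qed

text \<open>The monomialwise reduction \<open>r\<close> of \<open>p\<close> is multilinear and still vanishes on the cube. It is therefore
  the multilinear extension of the zero function, which by uniqueness is the zero polynomial.\<close>

lemma vanishing_imp_I2:
  assumes "finite V" "p \<in> polys_in V" "\<And>S. S \<subseteq> V \<Longrightarrow> eval_mpoly (indicator S) p = 0"
  shows "p \<in> I2 V"
proof -
  let ?red = "\<lambda>m. set_monomial (Poly_Mapping.keys m)"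
  define r where "r = (\<Sum>m\<in>Poly_Mapping.keys p. Poly_Mapping.single (?red m) (Poly_Mapping.lookup p m))"
  have keys: "Poly_Mapping.keys m \<subseteq> V" if "m \<in> Poly_Mapping.keys p" for m
    using assms(2) that by (auto simp: polys_in_def)
  have "p - r = (\<Sum>m\<in>Poly_Mapping.keys p. Poly_Mapping.single 0 (Poly_Mapping.lookup p m) *
      (Poly_Mapping.single m 1 - Poly_Mapping.single (?red m) 1))"
    by (simp add: r_def right_diff_distrib mult_single sum_subtractf sum_monomials)
  also have "\<dots> \<in> I2 V"
    by (intro I2_sum I2_mult I2_monomial_reduction keys) (auto simp: polys_in_def)
  finally have p_r: "p - r \<in> I2 V" .
  have keys_r: "Poly_Mapping.keys r \<subseteq> ?red ` Poly_Mapping.keys p"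
    unfolding r_def
    using keys_sum[of "\<lambda>m. Poly_Mapping.single (?red m) (Poly_Mapping.lookup p m)" "Poly_Mapping.keys p"]
    by (rule order_trans) auto
  have "is_mle V (\<lambda>_. 0) r"
    unfolding is_mle_def
  proof (intro conjI allI impI)
    show "r \<in> polys_in V" using keys_r keys by (fastforce simp: polys_in_def)
    show "multilinear r" using keys_r by (fastforce simp: multilinear_def lookup_set_monomial)
    show "eval_mpoly (indicator S) r = 0" if "S \<subseteq> V" for S
      using I2_vanishes[OF p_r, of S] assms(3)[OF that] by simp
  qed
  moreover have "is_mle V (\<lambda>_. 0) 0"
    by (simp add: is_mle_def multilinear_def)
  ultimately have "r = 0" using ex1_mle[OF assms(1)] by blast
  then show ?thesis using p_r by simp
qed

section \<open>Sums of squares on the cube\<close>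

text \<open>Only the values of \<open>h\<close> on subsets of \<open>V\<close> matter. Collecting the squares in a list makes addition
  of certificates concatenation.\<close>

definition cube_sos :: "nat set \<Rightarrow> nat \<Rightarrow> (nat set \<Rightarrow> real) \<Rightarrow> bool" where
  "cube_sos V t h \<longleftrightarrow> (\<exists>qs. set qs \<subseteq> bounded_polys V t \<and>
    (\<forall>S\<subseteq>V. h S = (\<Sum>q\<leftarrow>qs. (eval_mpoly (indicator S) q)\<^sup>2)))"

lemma cube_sos_cong: "(\<And>S. S \<subseteq> V \<Longrightarrow> g S = h S) \<Longrightarrow> cube_sos V t g \<longleftrightarrow> cube_sos V t h"
  unfolding cube_sos_def by auto

lemma cube_sos_zero: "cube_sos V t (\<lambda>_. 0)"
  unfolding cube_sos_def by (rule exI[of _ "[]"]) simp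

lemma cube_sos_add:
  assumes "cube_sos V t g" "cube_sos V t h"
  shows "cube_sos V t (\<lambda>S. g S + h S)"
proof -
  obtain ps where "set ps \<subseteq> bounded_polys V t"
      "\<forall>S\<subseteq>V. g S = (\<Sum>q\<leftarrow>ps. (eval_mpoly (indicator S) q)\<^sup>2)"
    using assms(1) unfolding cube_sos_def by blast
  moreover obtain qs where "set qs \<subseteq> bounded_polys V t"
      "\<forall>S\<subseteq>V. h S = (\<Sum>q\<leftarrow>qs. (eval_mpoly (indicator S) q)\<^sup>2)"
    using assms(2) unfolding cube_sos_def by blast
  ultimately show ?thesis unfolding cube_sos_def by (intro exI[of _ "ps @ qs"]) auto
qed

text \<open>The common form of scaling and of pulling back along a map \<open>\<phi>\<close> of the cube: both
  act on a certificate square by square.\<close>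

lemma cube_sos_transform:
  assumes h: "cube_sos V t h"
    and T: "\<And>q. q \<in> bounded_polys V t \<Longrightarrow> \<exists>q'\<in>bounded_polys V t. \<forall>S\<subseteq>V.
      (eval_mpoly (indicator S) q')\<^sup>2 = w * (eval_mpoly (indicator (\<phi> S)) q)\<^sup>2"
    and \<phi>: "\<And>S. S \<subseteq> V \<Longrightarrow> \<phi> S \<subseteq> V"
  shows "cube_sos V t (\<lambda>S. w * h (\<phi> S))"
proof -
  obtain qs where qs: "set qs \<subseteq> bounded_polys V t"
      "\<And>S. S \<subseteq> V \<Longrightarrow> h S = (\<Sum>q\<leftarrow>qs. (eval_mpoly (indicator S) q)\<^sup>2)"
    using h unfolding cube_sos_def by blast
  obtain \<tau> where \<tau>: "\<And>q. q \<in> bounded_polys V t \<Longrightarrow> \<tau> q \<in> bounded_polys V t"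
      "\<And>q S. q \<in> bounded_polys V t \<Longrightarrow> S \<subseteq> V \<Longrightarrow>
        (eval_mpoly (indicator S) (\<tau> q))\<^sup>2 = w * (eval_mpoly (indicator (\<phi> S)) q)\<^sup>2"
    using T by metis
  have "w * h (\<phi> S) = (\<Sum>q\<leftarrow>map \<tau> qs. (eval_mpoly (indicator S) q)\<^sup>2)" if "S \<subseteq> V" for S
  proof -
    have "(\<Sum>q\<leftarrow>map \<tau> qs. (eval_mpoly (indicator S) q)\<^sup>2)
        = (\<Sum>q\<leftarrow>qs. w * (eval_mpoly (indicator (\<phi> S)) q)\<^sup>2)"
      unfolding map_map comp_def using qs(1) \<tau>(2) that by (intro arg_cong[where f = sum_list] map_cong) auto
    then show ?thesis using qs(2)[OF \<phi>[OF that]] by (simp add: sum_list_const_mult)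
  qed
  moreover have "set (map \<tau> qs) \<subseteq> bounded_polys V t" using qs(1) \<tau>(1) by auto
  ultimately show ?thesis unfolding cube_sos_def by blast
qed

lemma cube_sos_scale:
  assumes "cube_sos V t h" "w \<ge> 0"
  shows "cube_sos V t (\<lambda>S. w * h S)"
proof (rule cube_sos_transform[OF assms(1), where \<phi> = "\<lambda>S. S"])
  fix q assume "q \<in> bounded_polys V t"
  then show "\<exists>q'\<in>bounded_polys V t. \<forall>S\<subseteq>V.
      (eval_mpoly (indicator S) q')\<^sup>2 = w * (eval_mpoly (indicator S) q)\<^sup>2"
    using assms(2) bounded_polys_mult[OF bounded_polys_const[of "sqrt w" V 0], of q t]
    by (intro bexI[of _ "Poly_Mapping.single 0 (sqrt w) * q"])
      (auto simp: power_mult_distrib eval_monomial_def)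
qed

lemma cube_sos_sum:
  assumes "\<And>r. r \<in> A \<Longrightarrow> cube_sos V t (h r)"
  shows "cube_sos V t (\<lambda>S. \<Sum>r\<in>A. h r S)"
  using assms by (induction A rule: infinite_finite_induct) (auto intro: cube_sos_zero cube_sos_add)

text \<open>A coordinatewise affine map of the cube preserves certificates, since composing a polynomial with it
  does not raise the degree.\<close>

lemma cube_sos_affine_pullback:
  assumes "cube_sos V t h"
    and "\<And>S. S \<subseteq> V \<Longrightarrow> \<phi> S \<subseteq> V"
    and aff: "\<And>S k. S \<subseteq> V \<Longrightarrow> k \<in> V \<Longrightarrow> indicator (\<phi> S) k = a k + b k * (indicator S k :: real)"
  shows "cube_sos V t (\<lambda>S. h (\<phi> S))"
proof -
  have "cube_sos V t (\<lambda>S. 1 * h (\<phi> S))"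
  proof (rule cube_sos_transform[OF assms(1)])
    fix q assume q: "q \<in> bounded_polys V t"
    obtain q' where q': "q' \<in> bounded_polys V t"
        "\<And>x. eval_mpoly x q' = eval_mpoly (\<lambda>k. a k + b k * x k) q"
      using bounded_polys_affine_substitution[OF q, of a b] by blast
    have "eval_mpoly (indicator S) q' = eval_mpoly (indicator (\<phi> S)) q" if "S \<subseteq> V" for S
      unfolding q'(2) by (rule eval_mpoly_cong[of q V]) (use q aff that in \<open>auto simp: bounded_polys_def\<close>)
    then show "\<exists>q'\<in>bounded_polys V t. \<forall>S\<subseteq>V.
        (eval_mpoly (indicator S) q')\<^sup>2 = 1 * (eval_mpoly (indicator (\<phi> S)) q)\<^sup>2"
      using q'(1) by (intro bexI[of _ q']) auto
  qed (use assms(2) in auto)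
  then show ?thesis by simp
qed

lemma sos_mod_I2_iff_cube_sos:
  assumes "finite V" "p \<in> polys_in V"
  shows "sos_mod (polys_in V) (I2 V) t p \<longleftrightarrow> cube_sos V t (\<lambda>S. eval_mpoly (indicator S) p)"
proof
  assume "sos_mod (polys_in V) (I2 V) t p"
  then obtain m :: nat and q where q: "\<And>r. r \<in> {1..m} \<Longrightarrow> q r \<in> bounded_polys V t"
      "p - (\<Sum>r=1..m. (q r)\<^sup>2) \<in> I2 V"
    unfolding sos_mod_def bounded_polys_def by blast
  have "eval_mpoly (indicator S) p = (\<Sum>r\<leftarrow>map q [1..<Suc m]. (eval_mpoly (indicator S) r)\<^sup>2)" for S
    using I2_vanishes[OF q(2), of S]
    unfolding map_map comp_def interv_sum_list_conv_sum_set_nat set_upt atLeastLessThanSuc_atLeastAtMost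
    by simp
  moreover have "set (map q [1..<Suc m]) \<subseteq> bounded_polys V t" using q(1) by auto
  ultimately show "cube_sos V t (\<lambda>S. eval_mpoly (indicator S) p)" unfolding cube_sos_def by blast
next
  assume "cube_sos V t (\<lambda>S. eval_mpoly (indicator S) p)"
  then obtain qs where qs: "set qs \<subseteq> bounded_polys V t"
      "\<And>S. S \<subseteq> V \<Longrightarrow> eval_mpoly (indicator S) p = (\<Sum>q\<leftarrow>qs. (eval_mpoly (indicator S) q)\<^sup>2)"
    unfolding cube_sos_def by blast
  let ?q = "\<lambda>r. qs ! (r - 1)"
  have q: "?q r \<in> polys_in V \<and> total_degree (?q r) \<le> t" if "r \<in> {1..length qs}" for r
    using qs(1) that nth_mem[of "r - 1" qs] by (fastforce simp: bounded_polys_def)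
  have "p - (\<Sum>r=1..length qs. (?q r)\<^sup>2) \<in> I2 V"
  proof (rule vanishing_imp_I2[OF assms(1)])
    show "p - (\<Sum>r=1..length qs. (?q r)\<^sup>2) \<in> polys_in V"
      using q unfolding power2_eq_square by (intro polys_in_diff assms(2) polys_in_sum polys_in_mult) auto
    show "eval_mpoly (indicator S) (p - (\<Sum>r=1..length qs. (?q r)\<^sup>2)) = 0" if "S \<subseteq> V" for S
    proof -
      have "(\<Sum>q\<leftarrow>qs. (eval_mpoly (indicator S) q)\<^sup>2)
          = (\<Sum>i<length qs. (eval_mpoly (indicator S) (qs ! i))\<^sup>2)"
        by (simp add: sum_list_sum_nth atLeast0LessThan)
      also have "\<dots> = (\<Sum>r=1..length qs. (eval_mpoly (indicator S) (?q r))\<^sup>2)"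
        by (rule sum.reindex_bij_witness[where i = "\<lambda>r. r - 1" and j = Suc]) auto
      finally show ?thesis using qs(2)[OF that] by simp
    qed
  qed
  with q show "sos_mod (polys_in V) (I2 V) t p"
    unfolding sos_mod_def by (intro exI[of _ "length qs"] exI[of _ ?q]) blast
qed

section \<open>Submodularity gaps\<close>

text \<open>Nonnegativity of this quantity for all \<open>S\<close> avoiding distinct \<open>i\<close> and \<open>j\<close> is ordinary
  submodularity.\<close>

definition submodularity_gap :: "(nat set \<Rightarrow> real) \<Rightarrow> nat \<Rightarrow> nat \<Rightarrow> nat set \<Rightarrow> real" where
  "submodularity_gap f i j S = f (insert i S) + f (insert j S) - f S - f (insert i (insert j S))"

lemma keys_partial_deriv:
  assumes "m \<in> Poly_Mapping.keys (partial_deriv i p)"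
  obtains m' where "m' \<in> Poly_Mapping.keys p" "m = m' - Poly_Mapping.single i 1"
proof -
  have "m \<in> (\<Union>m\<in>Poly_Mapping.keys p. Poly_Mapping.keys
      (Poly_Mapping.single (m - Poly_Mapping.single i 1) (real (Poly_Mapping.lookup m i) * Poly_Mapping.lookup p m)))"
    using assms unfolding partial_deriv_def by (rule subsetD[OF keys_sum])
  then show ?thesis using that by (auto split: if_splits)
qed

lemma multilinear_partial_deriv:
  assumes "multilinear p"
  shows "multilinear (partial_deriv i p)"
  unfolding multilinear_def
proof (intro ballI allI)
  fix m k assume "m \<in> Poly_Mapping.keys (partial_deriv i p)"
  then obtain m' where "m' \<in> Poly_Mapping.keys p" "m = m' - Poly_Mapping.single i 1"
    by (rule keys_partial_deriv)
  then show "Poly_Mapping.lookup m k \<le> 1"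
    using assms by (auto simp: multilinear_def lookup_minus intro: le_trans[OF diff_le_self])
qed

lemma polys_in_partial_deriv:
  assumes "multilinear p" "p \<in> polys_in V"
  shows "partial_deriv i p \<in> polys_in (V - {i})"
  unfolding polys_in_def
proof (intro CollectI ballI)
  fix m assume "m \<in> Poly_Mapping.keys (partial_deriv i p)"
  then obtain m' where m': "m' \<in> Poly_Mapping.keys p" and m: "m = m' - Poly_Mapping.single i 1"
    by (rule keys_partial_deriv)
  have "Poly_Mapping.keys m \<subseteq> Poly_Mapping.keys m'"
    unfolding m by (auto simp: in_keys_iff lookup_minus)
  moreover have "i \<notin> Poly_Mapping.keys m"
    using assms(1) m' unfolding m by (simp add: multilinear_def in_keys_iff lookup_minus)
  ultimately show "Poly_Mapping.keys m \<subseteq> V - {i}"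
    using assms(2) m' by (auto simp: polys_in_def)
qed

lemma eval_monomial_upd: "i \<notin> Poly_Mapping.keys m \<Longrightarrow> eval_monomial (x(i := c)) m = eval_monomial x m"
  unfolding eval_monomial_def by (rule prod.cong) auto

text \<open>A multilinear polynomial is an affine function of \<open>x\<^sub>i\<close> when the other variables are held fixed, so
  its slope is the difference of its values at \<open>x\<^sub>i = 1\<close> and \<open>x\<^sub>i = 0\<close>.\<close>

lemma eval_partial_deriv:
  assumes "multilinear p"
  shows "eval_mpoly x (partial_deriv i p) = eval_mpoly (x(i := 1)) p - eval_mpoly (x(i := 0)) p"
proof -
  let ?e = "Poly_Mapping.single i 1 :: monomial"
  have "real (Poly_Mapping.lookup m i) * eval_monomial x (m - ?e)
      = eval_monomial (x(i := 1)) m - eval_monomial (x(i := 0)) m"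
    if "m \<in> Poly_Mapping.keys p" for m
  proof (cases "Poly_Mapping.lookup m i = 0")
    case True
    then show ?thesis by (simp add: eval_monomial_upd in_keys_iff)
  next
    case False
    then have one: "Poly_Mapping.lookup m i = 1"
      using assms that unfolding multilinear_def by (metis le_antisym less_one not_le)
    have m: "m = (m - ?e) + ?e"
      by (rule poly_mapping_eqI) (use one in \<open>auto simp: lookup_add lookup_minus lookup_single when_def\<close>)
    have "i \<notin> Poly_Mapping.keys (m - ?e)" using one by (simp add: in_keys_iff lookup_minus)
    moreover have "eval_monomial (x(i := c)) ?e = c" for c by (simp add: eval_monomial_def)
    ultimately have "eval_monomial (x(i := c)) m = c * eval_monomial x (m - ?e)" for c
      by (subst m) (simp add: eval_monomial_add eval_monomial_upd)
    then show ?thesis using one by simp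
  qed
  then show ?thesis
    unfolding partial_deriv_def
    by (simp add: eval_mpoly_eq[of _ p] mult.assoc mult.left_commute[of "real _"]
        right_diff_distrib flip: sum_subtractf)
qed

lemma indicator_upd:
  "(indicator S)(i := 1) = (indicator (insert i S) :: nat \<Rightarrow> real)"
  "i \<notin> S \<Longrightarrow> (indicator S)(i := 0) = (indicator S :: nat \<Rightarrow> real)"
  by (auto simp: indicator_def fun_eq_iff)

lemma eval_second_partial_deriv_mle:
  assumes "is_mle \<Omega> f F" "i \<in> \<Omega>" "j \<in> \<Omega>" "i \<noteq> j" "S \<subseteq> \<Omega> - {i, j}"
  shows "eval_mpoly (indicator S) (- partial_deriv i (partial_deriv j F)) = submodularity_gap f i j S"
proof -
  have F: "multilinear F" "\<And>T. T \<subseteq> \<Omega> \<Longrightarrow> eval_mpoly (indicator T) F = f T"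
    using assms(1) by (auto simp: is_mle_def)
  have "i \<notin> S" "j \<notin> S" "j \<notin> insert i S" using assms by auto
  then have "eval_mpoly (indicator S) (partial_deriv i (partial_deriv j F))
      = (eval_mpoly (indicator (insert j (insert i S))) F - eval_mpoly (indicator (insert i S)) F)
        - (eval_mpoly (indicator (insert j S)) F - eval_mpoly (indicator S) F)"
    by (simp only: eval_partial_deriv multilinear_partial_deriv F(1) indicator_upd not_False_eq_True)
  also have "\<dots> = - submodularity_gap f i j S"
  proof -
    have "insert j (insert i S) \<subseteq> \<Omega>" "insert i S \<subseteq> \<Omega>" "insert j S \<subseteq> \<Omega>" "S \<subseteq> \<Omega>"
      using assms by auto
    then show ?thesis by (simp add: F(2) submodularity_gap_def insert_commute)
  qed
  finally show ?thesis by simp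
qed

text \<open>This replaces the multilinear extension and the ideal by a condition on the values of \<open>f\<close>; every
  closure property below is proved through it.\<close>

lemma sos_submodular_iff_gap_cube_sos:
  assumes "finite \<Omega>"
  shows "sos_submodular \<Omega> t f \<longleftrightarrow>
    (\<forall>i\<in>\<Omega>. \<forall>j\<in>\<Omega>. i \<noteq> j \<longrightarrow> cube_sos (\<Omega> - {i, j}) t (submodularity_gap f i j))"
proof -
  have F: "is_mle \<Omega> f (mle \<Omega> f)"
    unfolding mle_def by (rule theI'[OF ex1_mle[OF assms]])
  have "sos_mod (polys_in (\<Omega> - {i, j})) (I2 (\<Omega> - {i, j})) t (- partial_deriv i (partial_deriv j (mle \<Omega> f)))
      \<longleftrightarrow> cube_sos (\<Omega> - {i, j}) t (submodularity_gap f i j)"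
    if ij: "i \<in> \<Omega>" "j \<in> \<Omega>" "i \<noteq> j" for i j
  proof -
    have "multilinear (mle \<Omega> f)" "mle \<Omega> f \<in> polys_in \<Omega>"
      using F by (auto simp: is_mle_def)
    then have "partial_deriv i (partial_deriv j (mle \<Omega> f)) \<in> polys_in (\<Omega> - {j} - {i})"
      by (intro polys_in_partial_deriv multilinear_partial_deriv)
    moreover have "\<Omega> - {j} - {i} = \<Omega> - {i, j}" by auto
    ultimately have "- partial_deriv i (partial_deriv j (mle \<Omega> f)) \<in> polys_in (\<Omega> - {i, j})"
      by (simp add: polys_in_minus)
    then show ?thesis
      using assms eval_second_partial_deriv_mle[OF F ij]
      by (subst sos_mod_I2_iff_cube_sos) (auto intro!: cube_sos_cong simp del: eval_mpoly_minus)
  qed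
  then show ?thesis unfolding sos_submodular_def by blast
qed

section \<open>Operations preserving sos-submodularity\<close>

lemma sos_submodular_weighted_sum:
  assumes "finite \<Omega>" "\<And>r. r \<in> A \<Longrightarrow> sos_submodular \<Omega> t (f r)" "\<And>r. r \<in> A \<Longrightarrow> w r \<ge> 0"
  shows "sos_submodular \<Omega> t (\<lambda>S. \<Sum>r\<in>A. w r * f r S)"
  unfolding sos_submodular_iff_gap_cube_sos[OF assms(1)]
proof (intro ballI impI)
  fix i j assume "i \<in> \<Omega>" "j \<in> \<Omega>" "i \<noteq> j"
  then have "cube_sos (\<Omega> - {i, j}) t (\<lambda>S. \<Sum>r\<in>A. w r * submodularity_gap (f r) i j S)"
    using assms by (intro cube_sos_sum cube_sos_scale) (auto simp: sos_submodular_iff_gap_cube_sos)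
  moreover have "submodularity_gap (\<lambda>S. \<Sum>r\<in>A. w r * f r S) i j
      = (\<lambda>S. \<Sum>r\<in>A. w r * submodularity_gap (f r) i j S)"
    by (simp add: submodularity_gap_def fun_eq_iff algebra_simps sum.distrib sum_subtractf)
  ultimately show "cube_sos (\<Omega> - {i, j}) t (submodularity_gap (\<lambda>S. \<Sum>r\<in>A. w r * f r S) i j)"
    by simp
qed

text \<open>The common core of complementation, restriction and contraction. The gaps of \<open>g\<close> are compared with
  those of \<open>f\<close>, rather than \<open>g\<close> with \<open>f\<close> itself, because the relevant map \<open>\<phi>\<close> lives on the smaller
  cube without \<open>i\<close> and \<open>j\<close> and may depend on them.\<close>

lemma sos_submodular_affine_pullback:
  assumes "finite \<Omega>" "sos_submodular \<Omega> t f"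
    and gap: "\<And>i j. i \<in> \<Omega> \<Longrightarrow> j \<in> \<Omega> \<Longrightarrow> i \<noteq> j \<Longrightarrow>
      (\<forall>S\<subseteq>\<Omega> - {i, j}. submodularity_gap g i j S = 0) \<or>
      (\<exists>\<phi>. (\<forall>S\<subseteq>\<Omega> - {i, j}. \<phi> S \<subseteq> \<Omega> - {i, j} \<and>
          submodularity_gap g i j S = submodularity_gap f i j (\<phi> S) \<and>
          (\<forall>k\<in>\<Omega> - {i, j}. indicator (\<phi> S) k = a k + b k * (indicator S k :: real))))"
  shows "sos_submodular \<Omega> t g"
  unfolding sos_submodular_iff_gap_cube_sos[OF assms(1)]
proof (intro ballI impI)
  fix i j assume ij: "i \<in> \<Omega>" "j \<in> \<Omega>" "i \<noteq> j"
  let ?V = "\<Omega> - {i, j}"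
  from gap[OF ij] show "cube_sos ?V t (submodularity_gap g i j)"
  proof (elim disjE exE)
    assume "\<forall>S\<subseteq>?V. submodularity_gap g i j S = 0"
    then show ?thesis using cube_sos_zero by (subst cube_sos_cong[where h = "\<lambda>_. 0"]) auto
  next
    fix \<phi> assume \<phi>: "\<forall>S\<subseteq>?V. \<phi> S \<subseteq> ?V \<and>
        submodularity_gap g i j S = submodularity_gap f i j (\<phi> S) \<and>
        (\<forall>k\<in>?V. indicator (\<phi> S) k = a k + b k * (indicator S k :: real))"
    have "cube_sos ?V t (submodularity_gap f i j)"
      using assms(2) ij by (simp add: sos_submodular_iff_gap_cube_sos[OF assms(1)])
    then have "cube_sos ?V t (\<lambda>S. submodularity_gap f i j (\<phi> S))"
      by (rule cube_sos_affine_pullback[where a = a and b = b]) (use \<phi> in auto)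
    then show ?thesis
      by (subst cube_sos_cong[where h = "\<lambda>S. submodularity_gap f i j (\<phi> S)"]) (use \<phi> in auto)
  qed
qed

text \<open>Complementing exchanges the roles of the four sets in a gap: \<open>S\<close> with \<open>S + i + j\<close>, and \<open>S + i\<close>
  with \<open>S + j\<close>. The gap is symmetric under this, so it equals the gap of \<open>f\<close> at the complement of \<open>S\<close>
  relative to \<open>\<Omega> - {i, j}\<close>.\<close>

lemma sos_submodular_complement:
  assumes "finite \<Omega>" "sos_submodular \<Omega> t f"
  shows "sos_submodular \<Omega> t (\<lambda>S. f (\<Omega> - S))"
proof (rule sos_submodular_affine_pullback[OF assms, where a = "\<lambda>_. 1" and b = "\<lambda>_. - 1"],
    intro disjI2 exI allI impI)
  fix i j S assume ij: "i \<in> \<Omega>" "j \<in> \<Omega>" "i \<noteq> j" and S: "S \<subseteq> \<Omega> - {i, j}"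
  have "\<Omega> - insert i S = insert j (\<Omega> - {i, j} - S)" "\<Omega> - insert j S = insert i (\<Omega> - {i, j} - S)"
    "\<Omega> - S = insert i (insert j (\<Omega> - {i, j} - S))" "\<Omega> - insert i (insert j S) = \<Omega> - {i, j} - S"
    using ij S by auto
  then have "submodularity_gap (\<lambda>S. f (\<Omega> - S)) i j S = submodularity_gap f i j (\<Omega> - {i, j} - S)"
    by (simp add: submodularity_gap_def)
  then show "\<Omega> - {i, j} - S \<subseteq> \<Omega> - {i, j} \<and>
      submodularity_gap (\<lambda>S. f (\<Omega> - S)) i j S = submodularity_gap f i j (\<Omega> - {i, j} - S) \<and>
      (\<forall>k\<in>\<Omega> - {i, j}. indicator (\<Omega> - {i, j} - S) k = 1 + - 1 * (indicator S k :: real))"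
    by (auto simp: indicator_def)
qed

text \<open>If \<open>i\<close> or \<open>j\<close> lies outside \<open>A\<close>, adding it never changes the value of \<open>f (S \<inter> A)\<close> and the gap is zero.
  Otherwise it is the gap of \<open>f\<close> at \<open>S \<inter> A\<close>, which amounts to setting the variables outside \<open>A\<close>
  to 0.\<close>

lemma sos_submodular_restriction:
  assumes "finite \<Omega>" "sos_submodular \<Omega> t f"
  shows "sos_submodular \<Omega> t (\<lambda>S. f (S \<inter> A))"
proof (rule sos_submodular_affine_pullback[OF assms, where a = "\<lambda>_. 0" and b = "indicator A"])
  fix i j assume "i \<in> \<Omega>" "j \<in> \<Omega>" "i \<noteq> j"
  show "(\<forall>S\<subseteq>\<Omega> - {i, j}. submodularity_gap (\<lambda>S. f (S \<inter> A)) i j S = 0) \<or>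
      (\<exists>\<phi>. (\<forall>S\<subseteq>\<Omega> - {i, j}. \<phi> S \<subseteq> \<Omega> - {i, j} \<and>
          submodularity_gap (\<lambda>S. f (S \<inter> A)) i j S = submodularity_gap f i j (\<phi> S) \<and>
          (\<forall>k\<in>\<Omega> - {i, j}. indicator (\<phi> S) k = 0 + indicator A k * (indicator S k :: real))))"
  proof (cases "i \<in> A \<and> j \<in> A")
    case True
    then show ?thesis
      by (intro disjI2 exI[of _ "\<lambda>S. S \<inter> A"]) (auto simp: submodularity_gap_def indicator_def)
  next
    case False
    then show ?thesis
      by (intro disjI1) (auto simp: submodularity_gap_def Int_insert_left)
  qed
qed

text \<open>Dually to restriction, the gap is zero if \<open>i\<close> or \<open>j\<close> lies in \<open>A\<close>, and otherwise it is the gap of \<open>f\<close>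
  at \<open>S \<union> A\<close>, with the variables in \<open>A\<close> set to 1; the constant \<open>f A\<close> cancels.\<close>

lemma sos_submodular_contraction:
  assumes "finite \<Omega>" "sos_submodular \<Omega> t f" "A \<subseteq> \<Omega>"
  shows "sos_submodular \<Omega> t (\<lambda>S. f (S \<union> A) - f A)"
proof (rule sos_submodular_affine_pullback[OF assms(1,2),
      where a = "indicator A" and b = "\<lambda>k. 1 - indicator A k"])
  fix i j assume "i \<in> \<Omega>" "j \<in> \<Omega>" "i \<noteq> j"
  show "(\<forall>S\<subseteq>\<Omega> - {i, j}. submodularity_gap (\<lambda>S. f (S \<union> A) - f A) i j S = 0) \<or>
      (\<exists>\<phi>. (\<forall>S\<subseteq>\<Omega> - {i, j}. \<phi> S \<subseteq> \<Omega> - {i, j} \<and>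
          submodularity_gap (\<lambda>S. f (S \<union> A) - f A) i j S = submodularity_gap f i j (\<phi> S) \<and>
          (\<forall>k\<in>\<Omega> - {i, j}. indicator (\<phi> S) k
            = indicator A k + (1 - indicator A k) * (indicator S k :: real))))"
  proof (cases "i \<in> A \<or> j \<in> A")
    case True
    then show ?thesis
      by (intro disjI1) (auto simp: submodularity_gap_def insert_absorb)
  next
    case False
    then show ?thesis
      using assms(3)
      by (intro disjI2 exI[of _ "\<lambda>S. S \<union> A"]) (auto simp: submodularity_gap_def indicator_def)
  qed
qed

theorem proposition7:
  fixes t n :: nat
  shows
    "(\<forall>(m::nat) (f :: nat \<Rightarrow> nat set \<Rightarrow> real) (w :: nat \<Rightarrow> real).
        (\<forall>r\<in>{1..m}. sos_submodular {1..n} t (f r)) \<longrightarrow> (\<forall>r\<in>{1..m}. w r \<ge> 0) \<longrightarrow>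
        sos_submodular {1..n} t (\<lambda>S. \<Sum>r=1..m. w r * f r S)) \<and>
     (\<forall>f. sos_submodular {1..n} t f \<longrightarrow>
        sos_submodular {1..n} t (\<lambda>S. f ({1..n} - S))) \<and>
     (\<forall>f A. sos_submodular {1..n} t f \<longrightarrow> A \<subseteq> {1..n} \<longrightarrow>
        sos_submodular {1..n} t (\<lambda>S. f (S \<inter> A))) \<and>
     (\<forall>f A. sos_submodular {1..n} t f \<longrightarrow> A \<subseteq> {1..n} \<longrightarrow>
        sos_submodular {1..n} t (\<lambda>S. f (S \<union> A) - f A))"
  by (intro conjI allI impI sos_submodular_weighted_sum sos_submodular_complement
      sos_submodular_restriction sos_submodular_contraction) auto

end
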